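(* Let $m \geq 1$ and $k \geq 2$ be integers, let $w$ be an $m$-weighting of a graph $G$, and let $A = \{a_1,\ldots,a_r\}$ and $B = \{b_1,\ldots,b_r\}$ be disjoint $r$-element subsets of $V(G)$ such that (1) $a_i b_i \in E(G)$ for each $i \in [r]$; (2) $a_ia_j, a_ib_j, a_jb_i \in E(G)$ for every $i, j \in [r]$ with $b_ib_j \in E(G)$; and (3) $N_G(b_i) \setminus \left(A \cup \{v \in V(G) : w(v) = 0\}\right) \subseteq N_G(a_i)$ for each $i \in [r]$. Let $w'$ be the $m$-weighting of $G$ defined by $w'(v) = 0$ if $v \in A$, $w'(b_i) = w(b_i) + w(a_i)$ for each $i \in [r]$, and $w'(v) = w(v)$ for all other $v \in V(G)$. Then $\pi_k(G(w')) \leq \pi_k(G(w))$.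
   Context: All graphs are simple. $\mathbb{N}_0 = \{0,1,2,\dots\}$, $[r] = \{1,\dots,r\}$. $N_G(v)$ denotes the set of neighbours of $v$ in $G$. For a graph $G$, a function $w: V(G) \to \mathbb{N}_0$ with $\sum_{v \in V(G)} w(v) = m$ is an $m$-weighting of $G$. $G(w)$ is the graph obtained from $G$ by replacing each vertex $v$ by a clique $K^v$ on $w(v)$ vertices and joining every vertex of $K^u$ to every vertex of $K^v$ whenever $uv \in E(G)$. $\pi_k(H)$ denotes the number of $k$-cliques of a graph $H$. *)

theory Defs
  imports "HOL-Library.Ramsey"
begin

text \<open>
  A graph is given by a vertex set \<open>V\<close> and a set \<open>E\<close> of unordered pairs of vertices.
  \<open>V\<close> is not required to be finite.
\<close>

definition simple_graph :: "'a set \<Rightarrow> 'a set set \<Rightarrow> bool" where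
  "simple_graph V E \<longleftrightarrow> E \<subseteq> [V]\<^bsup>2\<^esup>"

definition neighbours :: "'a set \<Rightarrow> 'a set set \<Rightarrow> 'a \<Rightarrow> 'a set" where
  "neighbours V E v = {u \<in> V. {u, v} \<in> E}"

text \<open>
  For infinite \<open>V\<close>, the equation \<open>\<Sum>\<^sub>v w(v) = m\<close> in the natural numbers forces finite support, so
  the sum is taken over the support. (Isabelle's \<open>sum\<close> over an infinite set would be \<open>0\<close>.)
  For finite \<open>V\<close> this is the plain sum over \<open>V\<close>, see \<open>m_weighting_finite\<close>.
  Values of \<open>w\<close> outside \<open>V\<close> are irrelevant.
\<close>

definition m_weighting :: "'a set \<Rightarrow> nat \<Rightarrow> ('a \<Rightarrow> nat) \<Rightarrow> bool" where
  "m_weighting V m w \<longleftrightarrow>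
     finite {v \<in> V. w v \<noteq> 0} \<and> (\<Sum>v\<in>{v \<in> V. w v \<noteq> 0}. w v) = m"

lemma m_weighting_finite:
  assumes "finite V"
  shows "m_weighting V m w \<longleftrightarrow> (\<Sum>v\<in>V. w v) = m"
proof -
  have "(\<Sum>v\<in>{v \<in> V. w v \<noteq> 0}. w v) = (\<Sum>v\<in>V. w v)"
    using assms by (intro sum.mono_neutral_left) auto
  then show ?thesis
    using assms by (simp add: m_weighting_def)
qed

lemma m_weighting_superset:
  assumes "finite F" "F \<subseteq> V" "{v \<in> V. w v \<noteq> 0} \<subseteq> F"
  shows "m_weighting V m w \<longleftrightarrow> (\<Sum>v\<in>F. w v) = m"
proof -
  have "finite {v \<in> V. w v \<noteq> 0}"
    using assms by (rule_tac finite_subset)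
  moreover have "(\<Sum>v\<in>{v \<in> V. w v \<noteq> 0}. w v) = (\<Sum>v\<in>F. w v)"
    using assms by (intro sum.mono_neutral_left) auto
  ultimately show ?thesis
    by (simp add: m_weighting_def)
qed

lemma m_weighting_shift:
  fixes a b :: "nat \<Rightarrow> 'a" and w w' :: "'a \<Rightarrow> nat"
  assumes w: "m_weighting V m w"
    and A: "A = a ` {1..r}" and B: "B = b ` {1..r}"
    and sub: "A \<subseteq> V" "B \<subseteq> V"
    and card: "card A = r" "card B = r"
    and disj: "A \<inter> B = {}"
    and w'A: "\<forall>v\<in>A. w' v = 0"
    and w'B: "\<forall>i\<in>{1..r}. w' (b i) = w (b i) + w (a i)"
    and w'V: "\<forall>v\<in>V - (A \<union> B). w' v = w v"
  shows "m_weighting V m w'"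
proof -
  have inj: "inj_on a {1..r}" "inj_on b {1..r}"
    using A B card by (auto intro!: eq_card_imp_inj_on)
  define C where "C = {v \<in> V. w v \<noteq> 0} - (A \<union> B)"
  have fin: "finite A" "finite B" "finite C"
    using A B w by (auto simp: C_def m_weighting_def)
  have CAB: "(A \<union> B) \<inter> C = {}" "A \<union> B \<union> C \<subseteq> V"
    using sub by (auto simp: C_def)
  have split: "(\<Sum>v\<in>A \<union> B \<union> C. u v) = sum u A + sum u B + sum u C" for u :: "'a \<Rightarrow> nat"
    using fin CAB disj by (simp add: sum.union_disjoint)
  have "sum w' B = sum w B + sum w A"
    using w'B inj by (simp add: A B sum.reindex sum.distrib)
  moreover have "sum w' A = 0"
    using w'A by simp
  moreover have "sum w' C = sum w C"
    using w'V by (intro sum.cong) (auto simp: C_def)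
  ultimately have "(\<Sum>v\<in>A \<union> B \<union> C. w' v) = (\<Sum>v\<in>A \<union> B \<union> C. w v)"
    by (simp add: split)
  also have "\<dots> = m"
    using w fin CAB by (subst m_weighting_superset [symmetric, where V = V]) (auto simp: C_def)
  finally show ?thesis
    using fin CAB w'V by (subst m_weighting_superset [where F = "A \<union> B \<union> C"]) (auto simp: C_def)
qed

text \<open>
  The graph \<open>G(w)\<close>: the clique \<open>K\<^sup>v\<close> has vertex set \<open>{v} \<times> {..<w v}\<close>.
\<close>

definition blowup_verts :: "'a set \<Rightarrow> ('a \<Rightarrow> nat) \<Rightarrow> ('a \<times> nat) set" where
  "blowup_verts V w = (SIGMA v:V. {..<w v})"

definition blowup_edges :: "'a set \<Rightarrow> 'a set set \<Rightarrow> ('a \<Rightarrow> nat) \<Rightarrow> ('a \<times> nat) set set" where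
  "blowup_edges V E w =
     {{x, y} | x y. x \<in> blowup_verts V w \<and> y \<in> blowup_verts V w \<and> x \<noteq> y \<and>
        (fst x = fst y \<or> {fst x, fst y} \<in> E)}"

lemma simple_graph_blowup: "simple_graph (blowup_verts V w) (blowup_edges V E w)"
  by (auto simp: simple_graph_def blowup_edges_def)

lemma finite_blowup_verts:
  assumes "m_weighting V m w"
  shows "finite (blowup_verts V w)"
proof -
  have "blowup_verts V w = (SIGMA v:{v \<in> V. w v \<noteq> 0}. {..<w v})"
    by (auto simp: blowup_verts_def)
  then show ?thesis
    using assms by (auto simp: m_weighting_def)
qed

definition num_cliques :: "nat \<Rightarrow> 'a set \<Rightarrow> 'a set set \<Rightarrow> nat" where
  "num_cliques k V E = card {K \<in> [V]\<^bsup>k\<^esup>. clique K E}"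

end

theory Submission
  imports Defs
begin

text \<open>
  The last \<open>w (a\<^sub>i)\<close> copies of \<open>b\<^sub>i\<close> in \<open>G(w')\<close> are moved to the \<open>w (a\<^sub>i)\<close> copies of \<open>a\<^sub>i\<close> in \<open>G(w)\<close>,
  and every other vertex stays in place. The three conditions guarantee that this injection maps
  edges to edges, so it embeds the \<open>k\<close>-cliques of \<open>G(w')\<close> into those of \<open>G(w)\<close>.
\<close>

text \<open>Taking images under \<open>f\<close> is injective on subsets of \<open>V\<close>, keeps
  their size, and turns cliques into cliques because distinct image points have distinct, hence
  adjacent, preimages. Finiteness of \<open>V'\<close> matters since \<open>card\<close> of an
  infinite set is 0.\<close>

lemma num_cliques_le_of_inj_hom:
  assumes fin: "finite V'" and inj: "inj_on f V" and sub: "f ` V \<subseteq> V'"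
    and hom: "\<And>x y. x \<in> V \<Longrightarrow> y \<in> V \<Longrightarrow> x \<noteq> y \<Longrightarrow> {x, y} \<in> E \<Longrightarrow> {f x, f y} \<in> E'"
  shows "num_cliques k V E \<le> num_cliques k V' E'"
  unfolding num_cliques_def
proof (rule card_inj_on_le)
  show "inj_on ((`) f) {K \<in> [V]\<^bsup>k\<^esup>. clique K E}"
    using inj_on_image_Pow[OF inj] by (rule inj_on_subset) (auto simp: nsets_def)
  show "(`) f ` {K \<in> [V]\<^bsup>k\<^esup>. clique K E} \<subseteq> {K \<in> [V']\<^bsup>k\<^esup>. clique K E'}"
  proof clarify
    fix K assume K: "K \<in> [V]\<^bsup>k\<^esup>" "clique K E"
    then have KV: "K \<subseteq> V" by (auto simp: nsets_def)
    have "card (f ` K) = card K"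
      using inj KV by (meson card_image inj_on_subset)
    moreover have "clique (f ` K) E'"
      unfolding clique_def
    proof (intro ballI impI)
      fix u v assume "u \<in> f ` K" "v \<in> f ` K" "u \<noteq> v"
      then obtain x y where xy: "x \<in> K" "y \<in> K" "x \<noteq> y" "u = f x" "v = f y"
        by blast
      then have "{x, y} \<in> E"
        using K(2) by (simp add: clique_def)
      then show "{u, v} \<in> E'"
        using hom xy KV by blast
    qed
    ultimately show "f ` K \<in> [V']\<^bsup>k\<^esup> \<and> clique (f ` K) E'"
      using K(1) sub by (auto simp: nsets_def)
  qed
  show "finite {K \<in> [V']\<^bsup>k\<^esup>. clique K E'}"
    using fin by (simp add: finite_imp_finite_nsets)
qed

text \<open>An edge may arise from its endpoints in either order; the defining condition is
  symmetric, so it can be read off any naming of the two endpoints.\<close>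

lemma blowup_edges_iff:
  "{x, y} \<in> blowup_edges V E w \<longleftrightarrow>
     x \<in> blowup_verts V w \<and> y \<in> blowup_verts V w \<and> x \<noteq> y \<and> (fst x = fst y \<or> {fst x, fst y} \<in> E)"
  (is "?L \<longleftrightarrow> ?R")
proof
  assume ?L
  then obtain x' y' where "{x, y} = {x', y'}" and *: "x' \<in> blowup_verts V w"
    "y' \<in> blowup_verts V w" "x' \<noteq> y'" "fst x' = fst y' \<or> {fst x', fst y'} \<in> E"
    unfolding blowup_edges_def by blast
  then consider "x = x'" "y = y'" | "x = y'" "y = x'" by (auto simp: doubleton_eq_iff)
  then show ?R using * by cases (auto simp: insert_commute)
qed (unfold blowup_edges_def, blast)

theorem lemma4:
  fixes V :: "'a set" and E :: "'a set set"
    and m k r :: nat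
    and w w' :: "'a \<Rightarrow> nat"
    and a b :: "nat \<Rightarrow> 'a"
    and A B :: "'a set"
  assumes "m \<ge> 1" and "k \<ge> 2"
    and "simple_graph V E"
    and "m_weighting V m w"
    and "A = a ` {1..r}" and "B = b ` {1..r}"
    and "A \<subseteq> V" and "B \<subseteq> V"
    and "card A = r" and "card B = r"
    and "A \<inter> B = {}"
    and "\<forall>i\<in>{1..r}. {a i, b i} \<in> E"
    and "\<forall>i\<in>{1..r}. \<forall>j\<in>{1..r}. {b i, b j} \<in> E \<longrightarrow>
           {a i, a j} \<in> E \<and> {a i, b j} \<in> E \<and> {a j, b i} \<in> E"
    and "\<forall>i\<in>{1..r}.
           neighbours V E (b i) - (A \<union> {v \<in> V. w v = 0}) \<subseteq> neighbours V E (a i)"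
    and "\<forall>v\<in>A. w' v = 0"
    and "\<forall>i\<in>{1..r}. w' (b i) = w (b i) + w (a i)"
    and "\<forall>v\<in>V - (A \<union> B). w' v = w v"
  shows "num_cliques k (blowup_verts V w') (blowup_edges V E w')
           \<le> num_cliques k (blowup_verts V w) (blowup_edges V E w)"
proof -
  note w = assms(4) and A = assms(5) and B = assms(6) and sub = assms(7,8)
    and ab = assms(12) and bb = assms(13) and nb = assms(14)
    and w'A = assms(15) and w'B = assms(16) and w'V = assms(17)
  have inj: "inj_on a {1..r}" "inj_on b {1..r}"
    using A B assms(9,10) by (auto intro!: eq_card_imp_inj_on)
  \<comment> \<open>An index-free form of the pairing of \<open>b i\<close> with \<open>a i\<close>,
    meaningful only on \<open>B\<close>. The cardinality assumptions make both enumerations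
    injective, so it is well defined and injective there.\<close>
  define \<sigma> where "\<sigma> v = a (inv_into {1..r} b v)" for v
  have \<sigma>b: "\<sigma> (b i) = a i" if "i \<in> {1..r}" for i
    using inj(2) that by (simp add: \<sigma>_def)
  have \<sigma>A: "\<sigma> v \<in> A" if "v \<in> B" for v
    using that by (auto simp: A B \<sigma>b)
  have \<sigma>inj: "u = v" if "\<sigma> u = \<sigma> v" "u \<in> B" "v \<in> B" for u v
    using that inj(1) by (auto simp: B \<sigma>b inj_on_eq_iff)
  have w'\<sigma>: "w' v = w v + w (\<sigma> v)" if "v \<in> B" for v
    using that w'B \<sigma>b unfolding B by force
  have \<sigma>1: "{\<sigma> v, v} \<in> E" if "v \<in> B" for v
    using that ab \<sigma>b unfolding B by force
  have \<sigma>2: "{\<sigma> u, \<sigma> v} \<in> E" "{\<sigma> u, v} \<in> E" "{u, \<sigma> v} \<in> E"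
    if "u \<in> B" "v \<in> B" "{u, v} \<in> E" for u v
  proof -
    obtain i j where "i \<in> {1..r}" "u = b i" "j \<in> {1..r}" "v = b j"
      using \<open>u \<in> B\<close> \<open>v \<in> B\<close> B by auto
    then show "{\<sigma> u, \<sigma> v} \<in> E" "{\<sigma> u, v} \<in> E" "{u, \<sigma> v} \<in> E"
      using \<open>{u, v} \<in> E\<close> bb by (simp_all add: \<sigma>b insert_commute)
  qed
  have \<sigma>3: "{\<sigma> u, v} \<in> E" if "u \<in> B" "v \<in> V" "v \<notin> A" "w v \<noteq> 0" "{u, v} \<in> E" for u v
  proof -
    obtain i where i: "i \<in> {1..r}" "u = b i" using \<open>u \<in> B\<close> B by auto
    have "v \<in> neighbours V E (b i) - (A \<union> {v \<in> V. w v = 0})"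
      using that i by (auto simp: neighbours_def insert_commute)
    then have "v \<in> neighbours V E (a i)" using nb i(1) by blast
    then show ?thesis using i by (auto simp: neighbours_def \<sigma>b insert_commute)
  qed
  \<comment> \<open>Copies of \<open>b i\<close> with index at least \<open>w (b i)\<close> are the
    surplus ones; subtracting \<open>w (b i)\<close> renumbers them from 0, and the guard keeps the
    natural subtraction exact.\<close>
  define \<phi> where
    "\<phi> x = (if fst x \<in> B \<and> w (fst x) \<le> snd x then (\<sigma> (fst x), snd x - w (fst x)) else x)" for x
  have verts: "fst x \<in> V" "fst x \<notin> A" "fst x \<notin> B \<Longrightarrow> snd x < w (fst x)"
    if "x \<in> blowup_verts V w'" for x
  proof -
    show V: "fst x \<in> V" and nA: "fst x \<notin> A"
      using that w'A by (auto simp: blowup_verts_def)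
    show "snd x < w (fst x)" if "fst x \<notin> B"
      using \<open>x \<in> blowup_verts V w'\<close> w'V V nA that by (auto simp: blowup_verts_def)
  qed
  have \<phi>verts: "\<phi> x \<in> blowup_verts V w" if x: "x \<in> blowup_verts V w'" for x
  proof (cases "fst x \<in> B")
    case True
    then have "\<sigma> (fst x) \<in> V" using \<sigma>A sub(1) by blast
    then show ?thesis
      using x True w'\<sigma>[OF True] by (auto simp: \<phi>_def blowup_verts_def)
  next
    case False
    then show ?thesis
      using verts[OF x] by (cases x) (simp add: \<phi>_def blowup_verts_def)
  qed
  have \<phi>inj: "inj_on \<phi> (blowup_verts V w')"
  proof (rule inj_onI)
    fix x y assume xy: "x \<in> blowup_verts V w'" "y \<in> blowup_verts V w'" "\<phi> x = \<phi> y"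
    \<comment> \<open>Moved vertices land over \<open>A\<close>, while no vertex of the source
      blowup lies over \<open>A\<close>, so a moved and an unmoved vertex cannot collide.\<close>
    have "\<sigma> (fst x) \<noteq> fst y" if "fst x \<in> B"
      using \<sigma>A[OF that] verts(2)[OF xy(2)] by auto
    moreover have "\<sigma> (fst y) \<noteq> fst x" if "fst y \<in> B"
      using \<sigma>A[OF that] verts(2)[OF xy(1)] by auto
    ultimately show "x = y"
      using xy(3) \<sigma>inj[of "fst x" "fst y"] unfolding \<phi>_def
      by (cases x; cases y) (auto split: if_splits)
  qed
  have \<phi>adj: "fst (\<phi> x) = fst (\<phi> y) \<or> {fst (\<phi> x), fst (\<phi> y)} \<in> E"
    if x: "x \<in> blowup_verts V w'" and y: "y \<in> blowup_verts V w'"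
      and adj: "fst x = fst y \<or> {fst x, fst y} \<in> E" for x y
  proof (cases "fst x = fst y")
    case True
    \<comment> \<open>The only nontrivial case is two copies of one \<open>b i\<close> of which
      exactly one moves; the edge between \<open>a i\<close> and \<open>b i\<close> then joins their
      images.\<close>
    then show ?thesis
      using \<sigma>1[of "fst y"] by (simp add: \<phi>_def insert_commute)
  next
    case False
    then have e: "{fst x, fst y} \<in> E" "{fst y, fst x} \<in> E"
      using adj by (auto simp: insert_commute)
    \<comment> \<open>This can fail over \<open>B\<close>, where all copies may come from
      \<open>a i\<close>. Hence neighbours in \<open>B\<close> are handled by condition (2), and
      condition (3) is applied only to neighbours outside \<open>B\<close>.\<close>
    have out: "w (fst z) \<noteq> 0" if "z \<in> blowup_verts V w'" "fst z \<notin> B" for z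
      using verts(3)[OF that] by simp
    have xy: "{\<sigma> (fst x), fst y} \<in> E" if "fst x \<in> B"
      using \<sigma>2(2)[OF that _ e(1)] \<sigma>3[OF that verts(1,2)[OF y] out[OF y] e(1)] by blast
    have yx: "{fst x, \<sigma> (fst y)} \<in> E" if "fst y \<in> B"
      using \<sigma>2(2)[OF that _ e(2)] \<sigma>3[OF that verts(1,2)[OF x] out[OF x] e(2)]
      by (metis insert_commute)
    show ?thesis
      using e(1) xy yx \<sigma>2(1)[OF _ _ e(1)] by (simp add: \<phi>_def)
  qed
  show ?thesis
  proof (rule num_cliques_le_of_inj_hom[OF finite_blowup_verts[OF w] \<phi>inj])
    show "\<phi> ` blowup_verts V w' \<subseteq> blowup_verts V w"
      using \<phi>verts by blast
    show "{\<phi> x, \<phi> y} \<in> blowup_edges V E w"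
      if "x \<in> blowup_verts V w'" "y \<in> blowup_verts V w'" "x \<noteq> y"
        "{x, y} \<in> blowup_edges V E w'" for x y
      \<comment> \<open>Injectivity of \<open>\<phi>\<close> is used once more here: the images must
        be distinct to form an edge, notably when their first components agree.\<close>
      using that \<phi>verts \<phi>adj \<phi>inj unfolding blowup_edges_iff by (auto dest: inj_onD)
  qed
qed

end
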